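(* Let $K\in\mathcal{K}^n$ and let $b_1,\dots,b_n\in\mathbb{Z}^n$ be linearly independent. For $I\subseteq[n]$ let $L_I=\mathrm{span}\{b_i:i\in I\}$. Then $$\mathrm{vol}(K)\leq\sum_{I\subseteq[n]}\mathrm{G}_{\mathbb{Z}^n|L_I^\perp}\big((\mathrm{int}\,K)|L_I^\perp\big).$$ The inequality is tight, i.e., there are $K$ and $b_1,\dots,b_n$ for which equality holds.
   Context: $\mathcal{K}^n$ is the class of all compact convex sets in $\mathbb{R}^n$ with non-empty interior; $[n]=\{1,\dots,n\}$; $\mathrm{int}$ denotes the interior and $\mathrm{vol}$ the $n$-dimensional volume. For a linear subspace $L\subseteq\mathbb{R}^n$ and a set $A\subseteq\mathbb{R}^n$, $A|L$ is the image of $A$ under the orthogonal projection onto $L$, and $L^\perp$ is the orthogonal complement. Since $L_I$ is spanned by integer vectors, $\mathbb{Z}^n|L_I^\perp$ is a lattice in $L_I^\perp$. For a lattice $\Lambda$ and a set $A$, $\mathrm{G}_\Lambda(A)=|A\cap\Lambda|$. Conventions: $L_\emptyset=\{0\}$, and for $I=[n]$ one has $L_I^\perp=\{0\}$, with $\mathbb{Z}^n|L_I^\perp=\{0\}$. *)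

theory Defs
  imports "HOL-Analysis.Analysis"
begin

definition convex_bodies :: "(real ^ 'n) set set" where
  "convex_bodies = {K. compact K \<and> convex K \<and> interior K \<noteq> {}}"

definition int_lattice :: "(real ^ 'n) set" where
  "int_lattice = {x. \<forall>i. x $ i \<in> \<int>}"

text \<open>Linear independence of the indexed family: injectivity rules out repeated vectors, which
  independence of the range alone would not notice.\<close>

definition lin_indep_family :: "('i \<Rightarrow> 'a::real_vector) \<Rightarrow> bool" where
  "lin_indep_family b \<longleftrightarrow> inj b \<and> independent (range b)"

definition orth_proj :: "'a::euclidean_space set \<Rightarrow> 'a \<Rightarrow> 'a" where
  "orth_proj L x = (THE p. p \<in> L \<and> x - p \<in> L\<^sup>\<bottom>)"

text \<open>The set written A|L.\<close>

definition proj_set :: "'a::euclidean_space set \<Rightarrow> 'a set \<Rightarrow> 'a set" (infixl "\<downharpoonright>" 75) where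
  "A \<downharpoonright> L = orth_proj L ` A"

text \<open>Only meaningful when the intersection is finite, as for bounded A and a lattice.\<close>

definition lattice_count :: "'a set \<Rightarrow> 'a set \<Rightarrow> nat" where
  "lattice_count \<Lambda> A = card (A \<inter> \<Lambda>)"

definition span_family :: "('i \<Rightarrow> 'a::real_vector) \<Rightarrow> 'i set \<Rightarrow> 'a set" where
  "span_family b I = span (b ` I)"

lemma orth_proj_unique:
  fixes L :: "'a::euclidean_space set"
  assumes "subspace L"
  shows "\<exists>!p. p \<in> L \<and> x - p \<in> L\<^sup>\<bottom>"
proof -
  obtain p z where pz: "p \<in> span L" "\<And>w. w \<in> span L \<Longrightarrow> orthogonal z w" "x = p + z"
    using orthogonal_subspace_decomp_exists[of L x] by metis
  have sp: "span L = L" using assms by (simp add: span_eq_iff)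
  show ?thesis
  proof (rule ex1I[of _ p])
    show "p \<in> L \<and> x - p \<in> L\<^sup>\<bottom>"
      using pz sp by (auto simp: orthogonal_comp_def orthogonal_commute)
  next
    fix q assume q: "q \<in> L \<and> x - q \<in> L\<^sup>\<bottom>"
    have d: "p - q \<in> L" using q pz sp assms by (simp add: subspace_diff)
    have "orthogonal (p - q) (x - q)" "orthogonal (p - q) (x - p)"
      using q d pz(2)[of "p - q"] pz(3) sp
      by (simp_all add: orthogonal_comp_def orthogonal_commute)
    then have "(p - q) \<bullet> (p - q) = 0"
      by (simp add: orthogonal_def inner_diff_right)
    then show "q = p" by simp
  qed
qed

lemma orth_proj_mem:
  assumes "subspace L"
  shows "orth_proj L x \<in> L" "x - orth_proj L x \<in> L\<^sup>\<bottom>"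
  using theI'[OF orth_proj_unique[OF assms, of x]] unfolding orth_proj_def by auto

end

theory Submission
  imports Defs
begin

text \<open>
  By averaging over the unit cube it suffices to bound the number of integer points in every
  translate \<open>t + A\<close> of \<open>A = int K\<close>.  Write \<open>t\<close> in the basis \<open>b\<close> and remove one coordinate at a
  time, as in the proof of the Sauer-Shelah lemma.  On each line parallel to \<open>b\<^sub>i\<close> the lattice points
  of a convex set are consecutive, with some constant gap \<open>m b\<^sub>i\<close>, so their number is at most one plus
  the number of points whose successor also lies in the set.  The ones are counted by the
  projection along \<open>b\<^sub>i\<close>.  The remaining points lie in the intersection of two translates of \<open>A\<close>
  by multiples of \<open>b\<^sub>i\<close> that differ by \<open>m b\<^sub>i\<close>; after a further translation by a multiple of the
  lattice vector \<open>m b\<^sub>i\<close> this intersection is contained in \<open>A\<close> by convexity, which eliminates the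
  \<open>b\<^sub>i\<close>-coordinate of \<open>t\<close>.  The index set \<open>I\<close> records the directions that were projected out.
\<close>

section \<open>Subgroups and periods\<close>

lemma of_int_scale_mem:
  fixes G :: "'a::real_vector set"
  assumes "0 \<in> G" and diff: "\<And>x y. x \<in> G \<Longrightarrow> y \<in> G \<Longrightarrow> x - y \<in> G" and x: "x \<in> G"
  shows "of_int k *\<^sub>R x \<in> G"
proof (induction k rule: int_induct[where k = 0])
  case base
  show ?case using assms(1) by simp
next
  case (step1 i)
  have "0 - x \<in> G" using assms(1) x diff by blast
  then have "of_int i *\<^sub>R x - (0 - x) \<in> G" using step1 diff by blast
  then show ?case by (simp add: algebra_simps)
next
  case (step2 i)
  have "of_int i *\<^sub>R x - x \<in> G" using step2 diff x by blast
  then show ?case by (simp add: algebra_simps)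
qed

lemma sum_mem_subgroup:
  fixes G :: "'a::real_vector set"
  assumes "0 \<in> G" and diff: "\<And>x y. x \<in> G \<Longrightarrow> y \<in> G \<Longrightarrow> x - y \<in> G"
    and "\<And>i. i \<in> I \<Longrightarrow> f i \<in> G"
  shows "sum f I \<in> G"
  using assms(3)
proof (induction I rule: infinite_finite_induct)
  case (insert i I)
  have "0 - sum f I \<in> G" using insert by (intro diff assms(1)) auto
  moreover have "f i \<in> G" using insert by blast
  ultimately have "f i - (0 - sum f I) \<in> G" by (rule diff[rotated])
  then show ?case using insert by simp
qed (use assms(1) in auto)

text \<open>The smallest element \<open>m\<close> of \<open>D\<close> in (0,1] generates:
  \<open>m\<close> exists because 1 is a candidate and there are finitely many candidates, and
  reducing an element of \<open>D\<close> modulo \<open>m\<close> leaves a remainder in [0,m), which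
  minimality forces to be 0.\<close>

lemma real_subgroup_cyclic:
  fixes D :: "real set"
  assumes "1 \<in> D" and diff: "\<And>x y. x \<in> D \<Longrightarrow> y \<in> D \<Longrightarrow> x - y \<in> D"
    and fin: "finite (D \<inter> {0..1})"
  obtains m where "m > 0" "m \<in> D" "\<And>r. r \<in> D \<Longrightarrow> \<exists>k::int. r = of_int k * m"
proof -
  let ?P = "D \<inter> {0<..1}"
  have finP: "finite ?P" by (rule finite_subset[OF _ fin]) auto
  have neP: "?P \<noteq> {}" using assms(1) by auto
  define m where "m = Min ?P"
  have m: "m \<in> ?P" unfolding m_def using finP neP by (rule Min_in)
  have zero: "0 \<in> D" using diff[OF assms(1) assms(1)] by simp
  have "\<exists>k::int. r = of_int k * m" if r: "r \<in> D" for r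
  proof -
    define k where "k = \<lfloor>r / m\<rfloor>"
    have k: "of_int k * m \<le> r" "r < of_int k * m + m"
      using m floor_correct[of "r / m"] unfolding k_def[symmetric]
      by (auto simp: field_simps)
    have "of_int k *\<^sub>R m \<in> D" using m zero diff by (intro of_int_scale_mem) auto
    then have mem: "r - of_int k * m \<in> D" using r diff by simp
    have "r - of_int k * m \<in> ?P" if "r \<noteq> of_int k * m"
      using that mem k m by auto
    then have "r = of_int k * m"
      using Min_le[OF finP, of "r - of_int k * m"] k unfolding m_def[symmetric] by fastforce
    then show ?thesis by blast
  qed
  then show ?thesis using that m by auto
qed

text \<open>Points of \<open>H\<close> in one fibre of \<open>q\<close> differ by integer multiples
  of \<open>m *\<^sub>R w\<close>, and convexity makes those in \<open>C\<close> a run without gaps.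
  Only the last point of a run has its successor outside \<open>C\<close>, so \<open>q\<close> is
  injective on such points and the first summand counts them.\<close>

lemma card_convex_section_le:
  fixes H C :: "'a::real_vector set" and q :: "'a \<Rightarrow> 'b"
  assumes diff: "\<And>x y. x \<in> H \<Longrightarrow> y \<in> H \<Longrightarrow> x - y \<in> H"
    and ker: "\<And>x y. x \<in> H \<Longrightarrow> y \<in> H \<Longrightarrow> q x = q y \<Longrightarrow> \<exists>r. x - y = r *\<^sub>R w"
    and m: "m > 0" "m *\<^sub>R w \<in> H"
    and cyc: "\<And>r. r *\<^sub>R w \<in> H \<Longrightarrow> \<exists>k::int. r = of_int k * m"
    and "convex C" and fin: "finite (H \<inter> C)" "finite (q ` H \<inter> q ` C)"
  shows "card (H \<inter> C) \<le> card (q ` H \<inter> q ` C) + card (H \<inter> {x \<in> C. x + m *\<^sub>R w \<in> C})"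
proof -
  let ?Y = "{x \<in> H \<inter> C. x + m *\<^sub>R w \<notin> C}"
  have no_pos: False
    if x: "x \<in> ?Y" and y: "y \<in> ?Y" and k: "x - y = (of_int k * m) *\<^sub>R w" "k > 0" for x y k
  proof -
    \<comment> \<open>If \<open>x\<close> lies \<open>k\<close> steps beyond \<open>y\<close>, the
      successor of \<open>y\<close> divides the segment from \<open>y\<close> to \<open>x\<close> in
      ratio 1 : (k - 1), so it would belong to \<open>C\<close>.\<close>
    have "y + m *\<^sub>R w = (1 - 1 / of_int k) *\<^sub>R y + (1 / of_int k) *\<^sub>R x"
    proof -
      have "x = y + (of_int k * m) *\<^sub>R w" using k(1) by (simp add: algebra_simps)
      then show ?thesis using k(2) by (simp add: algebra_simps)
    qed
    moreover have "(1 - 1 / of_int k) *\<^sub>R y + (1 / of_int k) *\<^sub>R x \<in> C"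
      using x y k(2) \<open>convex C\<close> by (intro convexD) auto
    ultimately show False using y by simp
  qed
  have "inj_on q ?Y"
  proof (rule inj_onI)
    fix x y assume x: "x \<in> ?Y" and y: "y \<in> ?Y" and e: "q x = q y"
    then obtain r where r: "x - y = r *\<^sub>R w" using ker by blast
    moreover have "x - y \<in> H" using x y diff by blast
    ultimately obtain k :: int where k: "r = of_int k * m" using cyc by metis
    have "y - x = (of_int (- k) * m) *\<^sub>R w" using r k by (simp add: algebra_simps)
    then have "k = 0"
      using no_pos[OF x y, of k] no_pos[OF y x, of "- k"] r k by (cases k "0::int" rule: linorder_cases) auto
    then show "x = y" using r k by simp
  qed
  then have "card ?Y = card (q ` ?Y)" by (simp add: card_image)
  also have "\<dots> \<le> card (q ` H \<inter> q ` C)" using fin by (intro card_mono) auto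
  finally have Y: "card ?Y \<le> card (q ` H \<inter> q ` C)" .
  have "H \<inter> C = ?Y \<union> (H \<inter> {x \<in> C. x + m *\<^sub>R w \<in> C})" by auto
  then have "card (H \<inter> C) \<le> card ?Y + card (H \<inter> {x \<in> C. x + m *\<^sub>R w \<in> C})"
    using card_Un_le[of ?Y "H \<inter> {x \<in> C. x + m *\<^sub>R w \<in> C}"] by argo
  then show ?thesis using Y by simp
qed

section \<open>Projections along a subspace\<close>

text \<open>Since the double complement of \<open>L\<close> is \<open>L\<close>, projecting onto the
  complement means choosing a representative modulo \<open>L\<close>. Orthogonality enters the later
  counting only in this form.\<close>

lemma orth_proj_comp_eq_iff:
  fixes L :: "'a::euclidean_space set"
  assumes "subspace L"
  shows "orth_proj (L\<^sup>\<bottom>) x = y \<longleftrightarrow> y \<in> L\<^sup>\<bottom> \<and> x - y \<in> L"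
proof -
  have s: "subspace (L\<^sup>\<bottom>)" by (rule subspace_orthogonal_comp)
  have "(L\<^sup>\<bottom>)\<^sup>\<bottom> = L" using assms by (rule orthogonal_comp_self)
  then show ?thesis
    using orth_proj_unique[OF s, of x] orth_proj_mem[OF s, of x] by auto
qed

lemma linear_orth_proj_comp:
  fixes L :: "'a::euclidean_space set"
  assumes "subspace L"
  shows "linear (orth_proj (L\<^sup>\<bottom>))"
proof -
  have s: "subspace (L\<^sup>\<bottom>)" by (rule subspace_orthogonal_comp)
  have *: "orth_proj (L\<^sup>\<bottom>) x \<in> L\<^sup>\<bottom>" "x - orth_proj (L\<^sup>\<bottom>) x \<in> L" for x
    using orth_proj_comp_eq_iff[OF assms, of x] by auto
  show ?thesis
  proof (rule linearI)
    fix x y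
    have "(x - orth_proj (L\<^sup>\<bottom>) x) + (y - orth_proj (L\<^sup>\<bottom>) y) \<in> L"
      using * assms by (intro subspace_add)
    then show "orth_proj (L\<^sup>\<bottom>) (x + y) = orth_proj (L\<^sup>\<bottom>) x + orth_proj (L\<^sup>\<bottom>) y"
      unfolding orth_proj_comp_eq_iff[OF assms]
      using * s by (auto simp: algebra_simps intro: subspace_add)
  next
    fix c x
    have "c *\<^sub>R (x - orth_proj (L\<^sup>\<bottom>) x) \<in> L" using * assms by (intro subspace_scale)
    then show "orth_proj (L\<^sup>\<bottom>) (c *\<^sub>R x) = c *\<^sub>R orth_proj (L\<^sup>\<bottom>) x"
      unfolding orth_proj_comp_eq_iff[OF assms]
      using * s by (auto simp: algebra_simps intro: subspace_scale)
  qed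
qed

lemma orth_proj_comp_eq_proj_iff:
  fixes L :: "'a::euclidean_space set"
  assumes "subspace L"
  shows "orth_proj (L\<^sup>\<bottom>) x = orth_proj (L\<^sup>\<bottom>) y \<longleftrightarrow> x - y \<in> L"
proof -
  have "orth_proj (L\<^sup>\<bottom>) x = orth_proj (L\<^sup>\<bottom>) y \<longleftrightarrow> orth_proj (L\<^sup>\<bottom>) (x - y) = 0"
    by (simp add: linear_diff[OF linear_orth_proj_comp[OF assms]])
  also have "\<dots> \<longleftrightarrow> x - y \<in> L"
    by (simp add: orth_proj_comp_eq_iff[OF assms] subspace_0[OF subspace_orthogonal_comp])
  finally show ?thesis .
qed

lemma orth_proj_comp_absorb:
  fixes L M :: "'a::euclidean_space set"
  assumes "subspace L" "subspace M" "L \<subseteq> M"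
  shows "orth_proj (M\<^sup>\<bottom>) (orth_proj (L\<^sup>\<bottom>) x) = orth_proj (M\<^sup>\<bottom>) x"
proof -
  have "x - orth_proj (L\<^sup>\<bottom>) x \<in> L" using orth_proj_comp_eq_iff[OF assms(1), of x] by blast
  then show ?thesis
    using orth_proj_comp_eq_proj_iff[OF assms(2)] assms(3) by (metis subsetD)
qed

section \<open>Counting lattice points in translates\<close>

text \<open>A discrete subgroup stands in for the integer vectors: the counting works with closure
  under differences and finiteness in balls. The number of vectors is tied to the dimension only in
  \<open>card_translate_le\<close>.\<close>

locale lattice_family =
  fixes G :: "'a::euclidean_space set" and b :: "'i::finite \<Rightarrow> 'a"
  assumes zero_mem: "0 \<in> G"
    and diff_mem: "\<And>x y. x \<in> G \<Longrightarrow> y \<in> G \<Longrightarrow> x - y \<in> G"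
    and discrete: "\<And>r. finite (G \<inter> cball 0 r)"
    and family_mem: "\<And>i. b i \<in> G"
    and lin_indep: "lin_indep_family b"
begin

definition L :: "'i set \<Rightarrow> 'a set" where "L I = span_family b I"

definition P :: "'i set \<Rightarrow> 'a \<Rightarrow> 'a" where "P I = orth_proj ((L I)\<^sup>\<bottom>)"

lemma subspace_L: "subspace (L I)"
  by (simp add: L_def span_family_def)

lemma L_mono: "I \<subseteq> J \<Longrightarrow> L I \<subseteq> L J"
  by (simp add: L_def span_family_def span_mono image_mono)

lemma linear_P: "linear (P I)"
  unfolding P_def by (rule linear_orth_proj_comp[OF subspace_L])

lemma P_eq_iff: "P I x = P I y \<longleftrightarrow> x - y \<in> L I"
  unfolding P_def by (rule orth_proj_comp_eq_proj_iff[OF subspace_L])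

lemma P_absorb: "I \<subseteq> J \<Longrightarrow> P J (P I x) = P J x"
  unfolding P_def by (rule orth_proj_comp_absorb[OF subspace_L subspace_L L_mono])

lemma P_eq_0_iff: "P I x = 0 \<longleftrightarrow> x \<in> L I"
  using P_eq_iff[of I x 0] by (simp add: linear_0[OF linear_P])

lemma P_diff_mem: "x \<in> P I ` G \<Longrightarrow> y \<in> P I ` G \<Longrightarrow> x - y \<in> P I ` G"
  using diff_mem by (auto simp flip: linear_diff[OF linear_P])

lemma P_zero_mem: "0 \<in> P I ` G"
  using zero_mem linear_0[OF linear_P] by force

lemma P_family_nonzero:
  assumes "i \<notin> I"
  shows "P I (b i) \<noteq> 0"
proof -
  have ind: "independent (range b)" and inj: "inj b"
    using lin_indep by (auto simp: lin_indep_family_def)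
  have "b ` I \<subseteq> range b - {b i}" using assms inj by (auto dest: injD)
  then have "span (b ` I) \<subseteq> span (range b - {b i})" by (rule span_mono)
  moreover have "b i \<notin> span (range b - {b i})" using ind by (auto simp: dependent_def)
  ultimately have "b i \<notin> span (b ` I)" by blast
  then show ?thesis by (simp add: P_eq_0_iff L_def span_family_def)
qed

text \<open>Coefficients are attached to indices instead of vectors, so that they can be rounded or
  removed one direction at a time; injectivity of \<open>b\<close> permits the reindexing.\<close>

lemma mem_L_representation:
  assumes "x \<in> L I"
  obtains c where "x = (\<Sum>i\<in>I. c i *\<^sub>R b i)"
proof -
  have inj: "inj_on b I" using lin_indep by (auto simp: lin_indep_family_def intro: inj_on_subset)
  have "x \<in> span (b ` I)" using assms by (simp add: L_def span_family_def)
  then obtain u where "x = (\<Sum>v\<in>b ` I. u v *\<^sub>R v)"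
    by (auto simp: span_finite)
  then have "x = (\<Sum>i\<in>I. u (b i) *\<^sub>R b i)" by (simp add: sum.reindex[OF inj])
  then show ?thesis by (rule that[of "\<lambda>i. u (b i)"])
qed

text \<open>The projected lattice is again discrete because \<open>L I\<close> is spanned by vectors
  of \<open>G\<close>: each of its points over \<open>A\<close> lifts to a point of \<open>G\<close>
  whose distance from \<open>A\<close> is at most the sum of the norms of the \<open>b i\<close>,
  and a ball holds finitely many of these.\<close>

lemma finite_P_lattice:
  assumes "bounded A"
  shows "finite (P I ` G \<inter> P I ` A)"
proof -
  obtain R where R: "\<And>a. a \<in> A \<Longrightarrow> norm a \<le> R" using assms by (auto simp: bounded_iff)
  let ?R = "R + (\<Sum>i\<in>I. norm (b i))"
  have "P I ` G \<inter> P I ` A \<subseteq> P I ` (G \<inter> cball 0 ?R)"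
  proof
    fix y assume "y \<in> P I ` G \<inter> P I ` A"
    then obtain z a where za: "z \<in> G" "y = P I z" "a \<in> A" "y = P I a" by auto
    then have "z - a \<in> L I" using P_eq_iff by metis
    then obtain c where c: "z - a = (\<Sum>i\<in>I. c i *\<^sub>R b i)" by (rule mem_L_representation)
    \<comment> \<open>Subtracting the integer parts of the coefficients keeps \<open>z\<close> in
      \<open>G\<close> and keeps its projection, and leaves coefficients in [0,1) relative to
      \<open>a\<close>.\<close>
    define v where "v = (\<Sum>i\<in>I. of_int \<lfloor>c i\<rfloor> *\<^sub>R b i)"
    have vG: "v \<in> G" unfolding v_def
      using zero_mem diff_mem family_mem by (intro sum_mem_subgroup of_int_scale_mem) auto
    have vL: "v \<in> L I" unfolding v_def L_def span_family_def
      by (intro span_sum span_scale span_base) auto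
    have "z - v - a = (\<Sum>i\<in>I. frac (c i) *\<^sub>R b i)"
      using c unfolding v_def by (simp add: frac_def scaleR_diff_left sum_subtractf algebra_simps)
    moreover have "norm (\<Sum>i\<in>I. frac (c i) *\<^sub>R b i) \<le> (\<Sum>i\<in>I. norm (b i))"
      by (intro sum_norm_le) (auto simp: frac_lt_1 less_imp_le intro!: mult_left_le_one_le)
    ultimately have "norm (z - v) \<le> ?R"
      using R[OF za(3)] norm_triangle_sub[of "z - v" a] by simp
    moreover have "z - v \<in> G" using za vG diff_mem by blast
    moreover have "P I (z - v) = y" using P_eq_iff[of I "z - v" z] za vL
      by (simp add: subspace_neg[OF subspace_L])
    ultimately show "y \<in> P I ` (G \<inter> cball 0 ?R)" by auto
  qed
  then show ?thesis using discrete by (meson finite_imageI finite_subset)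
qed

text \<open>The scalars \<open>r\<close> form a subgroup of the reals. It contains 1 because
  \<open>b i\<close> is in \<open>G\<close>, and it meets [0,1] in a finite set because the
  projected segment from 0 to \<open>b i\<close> is bounded and \<open>P I (b i)\<close> is nonzero.
  The generator \<open>m\<close> can be smaller than 1.\<close>

lemma P_period:
  assumes "i \<notin> I"
  obtains m where "m > 0" "m *\<^sub>R P I (b i) \<in> P I ` G"
    "\<And>r. r *\<^sub>R P I (b i) \<in> P I ` G \<Longrightarrow> \<exists>k::int. r = of_int k * m"
proof -
  let ?w = "P I (b i)"
  let ?D = "{r. r *\<^sub>R ?w \<in> P I ` G}"
  have "bounded ((\<lambda>r. r *\<^sub>R b i) ` {0..1::real})"
    by (intro bounded_linear_image bounded_linear_scaleR_left) auto
  then have "finite (P I ` G \<inter> P I ` (\<lambda>r. r *\<^sub>R b i) ` {0..1::real})"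
    by (rule finite_P_lattice)
  moreover have "(\<lambda>r. r *\<^sub>R ?w) ` (?D \<inter> {0..1}) \<subseteq> P I ` G \<inter> P I ` (\<lambda>r. r *\<^sub>R b i) ` {0..1::real}"
    by (force simp: linear_scale[OF linear_P] image_image)
  ultimately have "finite ((\<lambda>r. r *\<^sub>R ?w) ` (?D \<inter> {0..1}))" by (rule rev_finite_subset)
  moreover have "inj_on (\<lambda>r. r *\<^sub>R ?w) (?D \<inter> {0..1})"
    using P_family_nonzero[OF assms] by (intro inj_onI) simp
  ultimately have "finite (?D \<inter> {0..1})" by (rule finite_imageD)
  moreover have "1 \<in> ?D" using family_mem by simp
  moreover have "x - y \<in> ?D" if "x \<in> ?D" "y \<in> ?D" for x y
    using that P_diff_mem[of "x *\<^sub>R ?w" I "y *\<^sub>R ?w"] by (simp add: scaleR_diff_left)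
  ultimately obtain m where "m > 0" "m \<in> ?D" "\<And>r. r \<in> ?D \<Longrightarrow> \<exists>k::int. r = of_int k * m"
    using real_subgroup_cyclic[of ?D] by metis
  then show ?thesis using that by simp
qed

section \<open>Removing the coordinates of a translation one at a time\<close>

definition N :: "'i set \<Rightarrow> 'a set \<Rightarrow> nat" where
  "N I A = card (P I ` G \<inter> P I ` A)"

text \<open>Inclusion is required of the projections only: the set \<open>A'\<close> from
  \<open>N_step\<close> lies in the image of \<open>A\<close> under \<open>P I\<close>, not in
  \<open>A\<close> itself.\<close>

lemma N_mono:
  assumes "bounded A" "P I ` B \<subseteq> P I ` A"
  shows "N I B \<le> N I A"
  unfolding N_def using assms finite_P_lattice by (intro card_mono) auto

lemma N_step:
  assumes A: "convex A" "bounded A" and i: "i \<notin> I"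
  obtains A' where "convex A'" "bounded A'" "A' \<subseteq> P I ` A"
    "N I ((\<lambda>x. s + c *\<^sub>R b i + x) ` A) \<le> N (insert i I) ((+) s ` A) + N I ((+) s ` A')"
proof -
  let ?w = "P I (b i)" and ?H = "P I ` G" and ?J = "insert i I"
  obtain m where m: "m > 0" "m *\<^sub>R ?w \<in> ?H"
    and cyc: "\<And>r. r *\<^sub>R ?w \<in> ?H \<Longrightarrow> \<exists>k::int. r = of_int k * m"
    using P_period[OF i] by metis
  define T where "T = (\<lambda>x. s + c *\<^sub>R b i + x) ` A"
  have T_eq: "T = (+) (s + c *\<^sub>R b i) ` A" by (simp add: T_def)
  have bT: "bounded T" unfolding T_eq using A by (simp add: bounded_translation)
  let ?C = "P I ` T"
  have cC: "convex ?C" unfolding T_eq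
    using A by (intro convex_linear_image linear_P convex_translation)
  have finC: "finite (?H \<inter> ?C)" using bT by (rule finite_P_lattice)
  have J: "P ?J ` P I ` X = P ?J ` X" for X by (auto simp: image_image P_absorb subset_insertI)
  \<comment> \<open>Modulo \<open>L I\<close>, an element of \<open>L ?J\<close> is a multiple of
    \<open>b i\<close>, so a fibre of \<open>P ?J\<close> on the projected lattice lies on a line in
    direction \<open>?w\<close>.\<close>
  have ker: "\<exists>r. x - y = r *\<^sub>R ?w" if xy: "x \<in> ?H" "y \<in> ?H" "P ?J x = P ?J y" for x y
  proof -
    have "x - y \<in> L ?J" using xy P_eq_iff by blast
    then have "\<exists>r. x - y - r *\<^sub>R b i \<in> L I"
      unfolding L_def span_family_def by (auto simp: span_breakdown_eq)
    then obtain r where "P I (x - y) = P I (r *\<^sub>R b i)" using P_eq_iff by metis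
    moreover have "P I (x - y) = x - y"
      using xy by (auto simp: linear_diff[OF linear_P] P_absorb)
    ultimately show ?thesis by (auto simp: linear_scale[OF linear_P])
  qed
  have "card (?H \<inter> ?C) \<le> card (P ?J ` ?H \<inter> P ?J ` ?C) + card (?H \<inter> {x \<in> ?C. x + m *\<^sub>R ?w \<in> ?C})"
    using P_diff_mem ker m cyc cC finC finite_P_lattice[OF bT, of ?J]
    by (intro card_convex_section_le) (auto simp: J)
  moreover have "P ?J ` ?C = P ?J ` (+) s ` A"
  proof -
    have "P ?J (b i) = 0" by (simp add: P_eq_0_iff L_def span_family_def span_base)
    then show ?thesis
      unfolding J unfolding T_eq image_image by (simp add: linear_add[OF linear_P] linear_scale[OF linear_P])
  qed
  ultimately have step: "N I T \<le> N ?J ((+) s ` A) + card (?H \<inter> {x \<in> ?C. x + m *\<^sub>R ?w \<in> ?C})"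
    by (simp add: N_def J)
  \<comment> \<open>\<open>d\<close> is the remainder of \<open>c\<close> modulo the period
    \<open>m\<close>. The \<open>k\<close> full periods form a lattice vector and can be translated
    away without changing the count.\<close>
  define k where "k = \<lfloor>c / m\<rfloor>"
  define d where "d = c - of_int k * m"
  have d: "0 \<le> d" "d \<le> m"
    using m floor_correct[of "c / m"] unfolding k_def[symmetric] d_def by (auto simp: field_simps)
  \<comment> \<open>After that shift by \<open>k\<close> periods and removal of
    \<open>P I s\<close>, the first set expresses that a point lies in the projected translate and
    the second that its successor does.\<close>
  define A' where "A' = (+) (d *\<^sub>R ?w) ` P I ` A \<inter> (+) ((d - m) *\<^sub>R ?w) ` P I ` A"
  have cPA: "convex (P I ` A)" using A linear_P by (intro convex_linear_image)
  have bPA: "bounded (P I ` A)" using A linear_P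
    by (simp add: bounded_linear_image linear_conv_bounded_linear)
  have "convex A'" unfolding A'_def using cPA by (intro convex_Int convex_translation)
  moreover have "bounded A'" unfolding A'_def using bPA by (simp add: bounded_translation bounded_Int)
  moreover have sub: "A' \<subseteq> P I ` A"
  proof
    fix x assume "x \<in> A'"
    then obtain u v where u: "u \<in> P I ` A" "x = d *\<^sub>R ?w + u"
      and v: "v \<in> P I ` A" "x = (d - m) *\<^sub>R ?w + v"
      unfolding A'_def by blast
    have "v = u + m *\<^sub>R ?w" using u(2) v(2) by (simp add: algebra_simps)
    \<comment> \<open>As \<open>d\<close> is in [0,m], the two translates are shifted in opposite
      senses by \<open>d\<close> and \<open>m - d\<close>, which places \<open>x\<close> on the
      segment between the two original points \<open>u\<close> and \<open>v\<close>.\<close>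
    then have "x = (1 - d / m) *\<^sub>R u + (d / m) *\<^sub>R v"
      using u(2) m by (simp add: algebra_simps)
    then show "x \<in> P I ` A" using u v d m convexD[OF cPA, of u v "1 - d / m" "d / m"] by simp
  qed
  moreover have "card (?H \<inter> {x \<in> ?C. x + m *\<^sub>R ?w \<in> ?C}) \<le> N I ((+) s ` A')"
  proof -
    let ?g = "\<lambda>x. x - of_int k *\<^sub>R (m *\<^sub>R ?w)"
    have kH: "of_int k *\<^sub>R (m *\<^sub>R ?w) \<in> ?H"
      using P_zero_mem P_diff_mem m by (intro of_int_scale_mem) auto
    have PA': "P I ` (+) s ` A' = (+) (P I s) ` A'"
    proof -
      have "P I x = x" if "x \<in> A'" for x
        using sub that P_absorb[of I I] by auto
      then show ?thesis by (force simp: image_image linear_add[OF linear_P])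
    qed
    have "?g ` (?H \<inter> {x \<in> ?C. x + m *\<^sub>R ?w \<in> ?C}) \<subseteq> ?H \<inter> P I ` (+) s ` A'"
    proof (rule image_subsetI)
      fix x assume x: "x \<in> ?H \<inter> {x \<in> ?C. x + m *\<^sub>R ?w \<in> ?C}"
      have "?g x \<in> ?H" using x kH P_diff_mem by blast
      moreover have "?g x - P I s \<in> A'"
      proof -
        obtain a a' where a: "a \<in> A" "x = P I (s + c *\<^sub>R b i + a)"
          and a': "a' \<in> A" "x + m *\<^sub>R ?w = P I (s + c *\<^sub>R b i + a')"
          using x by (auto simp: T_def)
        have "?g x - P I s = d *\<^sub>R ?w + P I a"
          using a by (simp add: d_def linear_add[OF linear_P] linear_scale[OF linear_P] algebra_simps)
        moreover have "x = P I s + c *\<^sub>R ?w + P I a' - m *\<^sub>R ?w"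
          using a' by (simp add: linear_add[OF linear_P] linear_scale[OF linear_P] algebra_simps)
        then have "?g x - P I s = (d - m) *\<^sub>R ?w + P I a'"
          by (simp add: d_def algebra_simps)
        ultimately show ?thesis unfolding A'_def using a a' by (metis IntI imageI)
      qed
      ultimately show "?g x \<in> ?H \<inter> P I ` (+) s ` A'" unfolding PA' by force
    qed
    moreover have "finite (?H \<inter> P I ` (+) s ` A')"
      using \<open>bounded A'\<close> by (intro finite_P_lattice) (simp add: bounded_translation)
    moreover have "inj_on ?g (?H \<inter> {x \<in> ?C. x + m *\<^sub>R ?w \<in> ?C})" by (intro inj_onI) simp
    ultimately show ?thesis unfolding N_def by (intro card_inj_on_le)
  qed
  ultimately show ?thesis using step unfolding T_def by (intro that[of A']) linarith+
qed

text \<open>Induction on \<open>F\<close> with \<open>I\<close> and \<open>A\<close> varying. For a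
  new direction \<open>i\<close>, the summand of \<open>N_step\<close> with
  \<open>insert i I\<close> yields the subsets containing \<open>i\<close>, and the summand with
  \<open>A'\<close> yields those avoiding \<open>i\<close>.\<close>

lemma N_translate_le:
  assumes "finite F" "F \<inter> I = {}" "convex A" "bounded A"
  shows "N I ((+) (\<Sum>i\<in>F. c i *\<^sub>R b i) ` A) \<le> (\<Sum>J\<in>Pow F. N (I \<union> J) A)"
  using assms
proof (induction F arbitrary: I A rule: finite_induct)
  case empty
  then show ?case by simp
next
  case (insert i F)
  let ?s = "\<Sum>i\<in>F. c i *\<^sub>R b i"
  have i: "i \<notin> I" using insert.prems by auto
  obtain A' where A': "convex A'" "bounded A'" "A' \<subseteq> P I ` A"
    "N I ((\<lambda>x. ?s + c i *\<^sub>R b i + x) ` A) \<le> N (insert i I) ((+) ?s ` A) + N I ((+) ?s ` A')"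
    using N_step[OF insert.prems(2,3) i, of ?s "c i"] by blast
  have e: "(+) (\<Sum>i\<in>insert i F. c i *\<^sub>R b i) ` A = (\<lambda>x. ?s + c i *\<^sub>R b i + x) ` A"
    using insert.hyps by (simp add: add.commute)
  have "N (insert i I) ((+) ?s ` A) \<le> (\<Sum>J\<in>Pow F. N (insert i I \<union> J) A)"
    using insert.prems insert.hyps by (intro insert.IH) auto
  also have "\<dots> = (\<Sum>J\<in>insert i ` Pow F. N (I \<union> J) A)"
  proof -
    have "inj_on (insert i) (Pow F)" using insert.hyps by (auto intro!: inj_onI)
    then show ?thesis by (simp add: sum.reindex)
  qed
  finally have 1: "N (insert i I) ((+) ?s ` A) \<le> (\<Sum>J\<in>insert i ` Pow F. N (I \<union> J) A)" .
  have "N I ((+) ?s ` A') \<le> (\<Sum>J\<in>Pow F. N (I \<union> J) A')"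
    using insert.prems A' by (intro insert.IH) auto
  also have "\<dots> \<le> (\<Sum>J\<in>Pow F. N (I \<union> J) A)"
  proof (intro sum_mono N_mono insert.prems)
    fix J
    have "P (I \<union> J) ` A' \<subseteq> P (I \<union> J) ` P I ` A" using A'(3) by (rule image_mono)
    then show "P (I \<union> J) ` A' \<subseteq> P (I \<union> J) ` A" by (simp add: image_image P_absorb)
  qed
  finally have 2: "N I ((+) ?s ` A') \<le> (\<Sum>J\<in>Pow F. N (I \<union> J) A)" .
  have "(\<Sum>J\<in>Pow (insert i F). N (I \<union> J) A)
      = (\<Sum>J\<in>Pow F. N (I \<union> J) A) + (\<Sum>J\<in>insert i ` Pow F. N (I \<union> J) A)"
    unfolding Pow_insert using insert.hyps by (intro sum.union_disjoint) auto
  then show ?case unfolding e using A'(4) 1 2 by linarith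
qed

lemma card_translate_le:
  assumes "convex A" "bounded A" "CARD('i) = DIM('a)"
  shows "card (G \<inter> (+) t ` A) \<le>
    (\<Sum>I\<in>Pow UNIV. lattice_count (G \<downharpoonright> (span_family b I)\<^sup>\<bottom>) (A \<downharpoonright> (span_family b I)\<^sup>\<bottom>))"
proof -
  have inj: "inj b" and ind: "independent (range b)"
    using lin_indep by (auto simp: lin_indep_family_def)
  have "card (range b) = DIM('a)" using inj assms(3) by (simp add: card_image)
  then have "UNIV \<subseteq> span (range b)"
    using ind by (intro card_ge_dim_independent) (auto simp: dim_UNIV)
  then have "t \<in> L UNIV" by (auto simp: L_def span_family_def)
  then obtain c where t: "t = (\<Sum>i\<in>UNIV. c i *\<^sub>R b i)" by (rule mem_L_representation)
  \<comment> \<open>\<open>L {}\<close> is the zero subspace, so starting the induction at the empty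
    index set counts the points of \<open>G\<close> itself.\<close>
  have id: "P {} x = x" for x using P_eq_iff[of "{}" "P {} x" x] P_absorb[of "{}" "{}" x]
    by (simp add: L_def span_family_def)
  have "N {} ((+) t ` A) \<le> (\<Sum>I\<in>Pow UNIV. N ({} \<union> I) A)"
    unfolding t using assms by (intro N_translate_le) auto
  moreover have "N {} ((+) t ` A) = card (G \<inter> (+) t ` A)"
    by (simp add: N_def id)
  ultimately show ?thesis
    by (simp add: N_def lattice_count_def proj_set_def P_def L_def Int_commute)
qed

end

section \<open>The integer lattice\<close>

lemma finite_int_lattice_bounded:
  fixes A :: "(real ^ 'n) set"
  assumes "bounded A"
  shows "finite (int_lattice \<inter> A)"
proof -
  obtain R where R: "\<And>a. a \<in> A \<Longrightarrow> norm a \<le> R" using assms by (auto simp: bounded_iff)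
  let ?S = "{x :: real ^ 'n. \<forall>i. x $ i \<in> of_int ` {-\<lceil>R\<rceil>..\<lceil>R\<rceil>}}"
  have "int_lattice \<inter> A \<subseteq> ?S"
  proof clarify
    fix x i assume x: "x \<in> int_lattice" "x \<in> A"
    then obtain k :: int where k: "x $ i = of_int k" by (auto simp: int_lattice_def elim: Ints_cases)
    have "\<bar>x $ i\<bar> \<le> R" using R[OF x(2)] component_le_norm_cart[of x i] by linarith
    then have "real_of_int k \<le> of_int \<lceil>R\<rceil>" "real_of_int (- \<lceil>R\<rceil>) \<le> of_int k"
      using le_of_int_ceiling[of R] unfolding k by linarith+
    then have "k \<in> {-\<lceil>R\<rceil>..\<lceil>R\<rceil>}" unfolding of_int_le_iff by simp
    then show "x $ i \<in> of_int ` {-\<lceil>R\<rceil>..\<lceil>R\<rceil>}" using k by blast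
  qed
  moreover have "finite ?S"
  proof (rule finite_subset)
    show "?S \<subseteq> (\<lambda>f. \<chi> i. f i) ` (UNIV \<rightarrow>\<^sub>E of_int ` {-\<lceil>R\<rceil>..\<lceil>R\<rceil>})"
    proof
      fix x :: "real ^ 'n"
      assume "x \<in> ?S"
      then have "(\<lambda>i. x $ i) \<in> UNIV \<rightarrow>\<^sub>E of_int ` {-\<lceil>R\<rceil>..\<lceil>R\<rceil>}" by auto
      then show "x \<in> (\<lambda>f. \<chi> i. f i) ` (UNIV \<rightarrow>\<^sub>E of_int ` {-\<lceil>R\<rceil>..\<lceil>R\<rceil>})"
        by (rule rev_image_eqI) simp
    qed
  qed (auto intro!: finite_imageI finite_PiE)
  ultimately show ?thesis by (rule finite_subset)
qed

lemma lattice_family_int_lattice: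
  fixes b :: "'i::finite \<Rightarrow> real ^ 'n"
  assumes "range b \<subseteq> int_lattice" "lin_indep_family b"
  shows "lattice_family int_lattice b"
proof
  show "finite (int_lattice \<inter> cball (0 :: real ^ 'n) r)" for r
    by (intro finite_int_lattice_bounded bounded_cball)
qed (use assms in \<open>auto simp: int_lattice_def\<close>)

lemma content_unit_cbox_cart: "measure lborel (cbox 0 (1 :: real ^ 'n)) = 1"
proof -
  have "(0 :: real ^ 'n) \<in> cbox 0 1" by (simp add: mem_box_cart)
  then have "cbox 0 (1 :: real ^ 'n) \<noteq> {}" by blast
  then show ?thesis by (simp add: content_cbox_cart)
qed

section \<open>Averaging over the unit cube\<close>

text \<open>Cut \<open>A\<close> along the integer grid and move every piece into the unit cube. The
  number of pieces over a point \<open>x\<close> of the cube is at most the number of integer points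
  in \<open>A - x\<close>, hence at most \<open>M\<close>, and the cube has volume 1.\<close>

lemma measure_le_card_translates:
  fixes A :: "(real ^ 'n) set"
  assumes A: "A \<in> lmeasurable" "bounded A"
    and card: "\<And>t. card (int_lattice \<inter> (+) t ` A) \<le> M"
  shows "measure lebesgue A \<le> real M"
proof -
  let ?C = "cbox 0 (1 :: real ^ 'n)"
  let ?T = "\<lambda>z. (+) (- z) ` A"
  \<comment> \<open>The corners \<open>z\<close> for which the cell \<open>z + ?C\<close> meets
    \<open>A\<close>; boundedness of \<open>A\<close> leaves finitely many.\<close>
  define Z where "Z = (int_lattice :: (real ^ 'n) set) \<inter> (\<Union>x\<in>A. \<Union>y\<in>?C. {x - y})"
  have bAC: "bounded (\<Union>x\<in>A. \<Union>y\<in>?C. {x - y})"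
    using A by (intro bounded_differences) auto
  have finZ: "finite Z" unfolding Z_def using bAC by (rule finite_int_lattice_bounded)
  have meas: "?T z \<inter> ?C \<in> lmeasurable" for z
    using A by (intro fmeasurable.Int lmeasurable_cbox measurable_translation)
  have cover: "A \<subseteq> (\<Union>z\<in>Z. (+) z ` (?T z \<inter> ?C))"
  proof
    fix x assume x: "x \<in> A"
    define z :: "real ^ 'n" where "z = (\<chi> i. of_int \<lfloor>x $ i\<rfloor>)"
    have c: "x - z \<in> ?C"
      by (auto simp: z_def mem_box_cart less_imp_le floor_correct) linarith+
    have "z \<in> int_lattice" by (simp add: int_lattice_def z_def)
    moreover have "z = x - (x - z)" by simp
    ultimately have "z \<in> Z" using x c unfolding Z_def by blast
    moreover have "x - z \<in> ?T z" using x by auto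
    moreover have "x = z + (x - z)" by simp
    ultimately show "x \<in> (\<Union>z\<in>Z. (+) z ` (?T z \<inter> ?C))" using c by blast
  qed
  have meas': "(+) z ` (?T z \<inter> ?C) \<in> lmeasurable" for z
    using meas by (rule measurable_translation)
  have "measure lebesgue A \<le> measure lebesgue (\<Union>z\<in>Z. (+) z ` (?T z \<inter> ?C))"
    using cover A finZ meas' by (intro measure_mono_fmeasurable fmeasurable.finite_UN) auto
  also have "\<dots> \<le> (\<Sum>z\<in>Z. measure lebesgue ((+) z ` (?T z \<inter> ?C)))"
    using finZ meas' by (intro measure_UNION_le) auto
  also have "\<dots> = (\<Sum>z\<in>Z. measure lebesgue (?T z \<inter> ?C))"
    by (simp only: measure_translation)
  also have "\<dots> = (\<Sum>z\<in>Z. integral ?C (indicat_real (?T z)))"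
    using meas by (intro sum.cong) (auto simp: integral_indicator Int_commute)
  also have "\<dots> = integral ?C (\<lambda>x. \<Sum>z\<in>Z. indicat_real (?T z) x)"
    using finZ meas by (subst integral_sum) (auto simp: integrable_on_indicator)
  also have "\<dots> \<le> integral ?C (\<lambda>x. real M)"
  proof (rule integral_le)
    show "(\<lambda>x. \<Sum>z\<in>Z. indicat_real (?T z) x) integrable_on ?C"
      using finZ meas by (intro integrable_sum) (auto simp: integrable_on_indicator)
    fix x
    \<comment> \<open>A point \<open>x\<close> lies in \<open>A - z\<close> exactly when
      \<open>z\<close> lies in \<open>A - x\<close>, so the overlap at \<open>x\<close> becomes a
      count for the translate of \<open>A\<close> by \<open>- x\<close>.\<close>
    have "(\<Sum>z\<in>Z. indicat_real (?T z) x) = real (card {z \<in> Z. x \<in> ?T z})"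
      using finZ by (simp add: sum.If_cases indicator_def of_bool_def Int_def)
    also have "\<dots> \<le> real (card (int_lattice \<inter> (+) (- x) ` A))"
    proof -
      have "bounded ((+) (- x) ` A)" using A(2) by (rule bounded_translation)
      moreover have "{z \<in> Z. x \<in> ?T z} \<subseteq> int_lattice \<inter> (+) (- x) ` A"
        unfolding Z_def by (auto simp: algebra_simps)
      ultimately show ?thesis
        using finite_int_lattice_bounded card_mono of_nat_mono by blast
    qed
    also have "\<dots> \<le> real M" using card of_nat_mono by blast
    finally show "(\<Sum>z\<in>Z. indicat_real (?T z) x) \<le> real M" .
  qed (auto)
  also have "\<dots> = real M" by (simp add: content_unit_cbox_cart)
  finally show ?thesis .
qed

lemma measure_convex_body_le:
  fixes K :: "(real ^ 'n) set" and b :: "'n \<Rightarrow> real ^ 'n"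
  assumes "K \<in> convex_bodies" "range b \<subseteq> int_lattice" "lin_indep_family b"
  shows "measure lebesgue K \<le>
    (\<Sum>I\<in>Pow UNIV. real (lattice_count (int_lattice \<downharpoonright> (span_family b I)\<^sup>\<bottom>)
                                     (interior K \<downharpoonright> (span_family b I)\<^sup>\<bottom>)))"
proof -
  interpret lattice_family int_lattice b using assms(2,3) by (rule lattice_family_int_lattice)
  have K: "compact K" "convex K" using assms(1) by (auto simp: convex_bodies_def)
  have bK: "bounded (interior K)" using K compact_imp_bounded bounded_interior by blast
  \<comment> \<open>The frontier of a convex set is negligible, so the volume may be computed on the
    interior, which is the set being counted.\<close>
  have "measure lebesgue K = measure lebesgue (interior K)"
    using K negligible_convex_frontier measure_interior compact_imp_bounded by metis
  also have "\<dots> \<le> real (\<Sum>I\<in>Pow UNIV. lattice_count (int_lattice \<downharpoonright> (span_family b I)\<^sup>\<bottom>)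
                                     (interior K \<downharpoonright> (span_family b I)\<^sup>\<bottom>))"
    using bK K by (intro measure_le_card_translates lmeasurable_interior card_translate_le)
      (auto simp: compact_imp_bounded)
  finally show ?thesis by simp
qed

section \<open>Equality for the unit cube\<close>

text \<open>With the standard basis, every proper \<open>I\<close> contributes 0, since a coordinate
  outside \<open>I\<close> survives the projection and is never an integer on the open cube. For
  \<open>I = UNIV\<close> everything projects to 0 and contributes 1, the volume of the
  cube.\<close>

lemma unit_cube_tight:
  defines "K \<equiv> cbox 0 (1 :: real ^ 'n)" and "b \<equiv> \<lambda>i :: 'n. axis i (1::real)"
  shows "K \<in> convex_bodies" "range b \<subseteq> int_lattice" "lin_indep_family b"
    "measure lebesgue K =
      (\<Sum>I\<in>Pow UNIV. real (lattice_count (int_lattice \<downharpoonright> (span_family b I)\<^sup>\<bottom>)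
                                     (interior K \<downharpoonright> (span_family b I)\<^sup>\<bottom>)))"
proof -
  have half: "(\<chi> i. 1 / 2) \<in> interior K" by (simp add: K_def interior_cbox mem_box_cart)
  then show "K \<in> convex_bodies" by (auto simp: convex_bodies_def K_def)
  show bint: "range b \<subseteq> int_lattice" by (auto simp: b_def int_lattice_def axis_def)
  have range_b: "range b = Basis" by (auto simp: b_def Basis_vec_def)
  show li: "lin_indep_family b"
    unfolding lin_indep_family_def range_b
    by (auto simp: b_def axis_eq_axis independent_Basis intro: injI)
  interpret lattice_family int_lattice b using bint li by (rule lattice_family_int_lattice)
  have count: "lattice_count (int_lattice \<downharpoonright> (span_family b I)\<^sup>\<bottom>) (interior K \<downharpoonright> (span_family b I)\<^sup>\<bottom>)
      = N I (interior K)" for I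
    by (simp add: lattice_count_def proj_set_def N_def P_def L_def Int_commute)
  have "N I (interior K) = 0" if I: "I \<noteq> UNIV" for I
  proof -
    obtain j where j: "j \<notin> I" using I by blast
    have False if za: "z \<in> int_lattice" "a \<in> interior K" "P I z = P I a" for z a
    proof -
      have "z - a \<in> L I" using za P_eq_iff by blast
      then obtain c where c: "z - a = (\<Sum>i\<in>I. c i *\<^sub>R b i)" by (rule mem_L_representation)
      \<comment> \<open>No basis vector indexed by \<open>I\<close> has a \<open>j\<close>-th entry,
        so \<open>z\<close> and \<open>a\<close> agree there, although one entry is an integer and
        the other is strictly between 0 and 1.\<close>
      have "(z - a) $ j = 0" unfolding c using j by (auto simp: b_def axis_def intro!: sum.neutral)
      then have "z $ j = a $ j" by simp
      moreover have "0 < a $ j" "a $ j < 1"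
        using za(2) by (auto simp: K_def interior_cbox mem_box_cart)
      moreover have "z $ j \<in> \<int>" using za(1) by (simp add: int_lattice_def)
      ultimately show False using Ints_nonzero_abs_less1[of "z $ j"] by linarith
    qed
    then have "P I ` int_lattice \<inter> P I ` interior K = {}" by blast
    then show ?thesis by (simp add: N_def)
  qed
  moreover have "N UNIV (interior K) = 1"
  proof -
    have "P UNIV x = 0" for x
      by (simp add: P_eq_0_iff L_def span_family_def range_b)
    then have "P UNIV ` int_lattice \<inter> P UNIV ` interior K = {0}"
      using half zero_mem by (auto simp: image_iff)
    then show ?thesis by (simp add: N_def)
  qed
  ultimately have "(\<Sum>I\<in>Pow UNIV. real (N I (interior K))) =
      (\<Sum>I\<in>Pow (UNIV :: 'n set). if I = UNIV then 1 else 0)"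
    by (intro sum.cong) auto
  then show "measure lebesgue K =
      (\<Sum>I\<in>Pow UNIV. real (lattice_count (int_lattice \<downharpoonright> (span_family b I)\<^sup>\<bottom>)
                                     (interior K \<downharpoonright> (span_family b I)\<^sup>\<bottom>)))"
    unfolding count by (simp add: K_def content_unit_cbox_cart)
qed

theorem theorem1p3:
  shows "(\<forall>(K :: (real ^ 'n) set) (b :: 'n \<Rightarrow> real ^ 'n).
            K \<in> convex_bodies \<longrightarrow> range b \<subseteq> int_lattice \<longrightarrow> lin_indep_family b \<longrightarrow>
            measure lebesgue K \<le>
              (\<Sum>I\<in>Pow (UNIV :: 'n set).
                 real (lattice_count (int_lattice \<downharpoonright> (span_family b I)\<^sup>\<bottom>)
                                     (interior K \<downharpoonright> (span_family b I)\<^sup>\<bottom>))))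
       \<and> (\<exists>(K :: (real ^ 'n) set) (b :: 'n \<Rightarrow> real ^ 'n).
            K \<in> convex_bodies \<and> range b \<subseteq> int_lattice \<and> lin_indep_family b \<and>
            measure lebesgue K =
              (\<Sum>I\<in>Pow (UNIV :: 'n set).
                 real (lattice_count (int_lattice \<downharpoonright> (span_family b I)\<^sup>\<bottom>)
                                     (interior K \<downharpoonright> (span_family b I)\<^sup>\<bottom>))))"
  using measure_convex_body_le unit_cube_tight by blast

end
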